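(* The vertical foliation on the Moore surface $M$ has no compatible Whitney flow, i.e. there is no flow on $M$ whose orbits are exactly the leaves of the vertical foliation.
   Context: The bordered Prüfer surface $P$: as a set, $P=H\sqcup\bigsqcup_{x\in\mathbb{R}}R_x$, where $H=\mathbb{R}\times\mathbb{R}_{>0}$ and $R_x=\{r_{x,s}: s\in\mathbb{R}\}$, $r_{x,s}$ being thought of as the ray issuing from $(x,0)$ into $H$ with slope $s=\Delta x/\Delta y$. For each $x\in\mathbb{R}$ let $\varphi_x\colon\mathbb{R}\times[0,\infty)\to H\cup R_x$ be the bijection $\varphi_x(s,y)=(x+sy,y)$ for $y>0$ and $\varphi_x(s,0)=r_{x,s}$. The topology of $P$ is the one for which every $\varphi_x$ is a homeomorphism onto an open subset $H\cup R_x$ of $P$. Then $P$ is a Hausdorff non-metrizable $2$-manifold with boundary, with boundary components $R_x\cong\mathbb{R}$. The Moore surface $M$ is the quotient of $P$ by the identifications $r_{x,s}\sim r_{x,-s}$ for all $x,s\in\mathbb{R}$; it is a Hausdorff non-metrizable $2$-manifold without boundary. Let $T_x\subset M$ denote the image of $R_x$ (homeomorphic to $[0,\infty)$, with endpoint the class of $r_{x,0}$). The vertical foliation of $M$ is the foliation induced from the partition of $P$ by the curves $x=\mathrm{const}$; its leaves are the sets $(\{x\}\times\mathbb{R}_{>0})\cup T_x$, $x\in\mathbb{R}$. A flow on $M$ is a continuous action $f\colon\mathbb{R}\times M\to M$ of the additive group $\mathbb{R}$; orbits are the sets $f(\mathbb{R}\times\{p\})$. *)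

theory Defs
  imports "HOL-Analysis.Analysis"
begin

section \<open>The bordered Pruefer surface\<close>

text \<open>\<open>Half x y\<close> is the point \<open>(x, y)\<close> of the upper half-plane \<open>H\<close> and is used only for
  \<open>y > 0\<close>; \<open>Ray x s\<close> is the boundary point \<open>r\<^sub>x\<^sub>,\<^sub>s\<close>.\<close>

datatype prufer_point = Half real real | Ray real real

definition upper_half :: "prufer_point set" where
  "upper_half = {Half x y | x y. y > 0}"

definition rays :: "real \<Rightarrow> prufer_point set" where
  "rays x = range (Ray x)"

definition prufer_points :: "prufer_point set" where
  "prufer_points = upper_half \<union> (\<Union>x. rays x)"

definition closed_half_plane :: "(real \<times> real) set" where
  "closed_half_plane = UNIV \<times> {0..}"

text \<open>The map \<open>\<phi>\<^sub>x\<close>, of interest on \<open>closed_half_plane\<close> only.\<close>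

definition prufer_chart :: "real \<Rightarrow> real \<times> real \<Rightarrow> prufer_point" where
  "prufer_chart x = (\<lambda>(s, y). if y > 0 then Half (x + s * y) y else Ray x s)"

text \<open>The final topology for the family of all \<open>\<phi>\<^sub>x\<close>. The lemmas
  \<open>prufer_chart_homeomorphism\<close>, \<open>prufer_chart_open\<close> and \<open>prufer_unique\<close> below show that it is
  the one and only topology for which every \<open>\<phi>\<^sub>x\<close> is a homeomorphism onto an open
  subset \<open>H \<union> R\<^sub>x\<close>.\<close>

definition prufer :: "prufer_point topology" where
  "prufer = topology (\<lambda>U. U \<subseteq> prufer_points \<and>
     (\<forall>x. openin (top_of_set closed_half_plane) {p \<in> closed_half_plane. prufer_chart x p \<in> U}))"

lemma openin_prufer:
  "openin prufer U \<longleftrightarrow> U \<subseteq> prufer_points \<and>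
     (\<forall>x. openin (top_of_set closed_half_plane) {p \<in> closed_half_plane. prufer_chart x p \<in> U})"
proof -
  let ?pre = "\<lambda>x U. {p \<in> closed_half_plane. prufer_chart x p \<in> U}"
  have 1: "?pre x (S \<inter> T) = ?pre x S \<inter> ?pre x T" for x S T by auto
  have 2: "?pre x (\<Union>\<K>) = (\<Union>K\<in>\<K>. ?pre x K)" for x \<K> by auto
  have "istopology (\<lambda>U. U \<subseteq> prufer_points \<and>
     (\<forall>x. openin (top_of_set closed_half_plane) (?pre x U)))"
    unfolding istopology_def 1 2 by auto
  then show ?thesis
    by (simp add: prufer_def)
qed

lemma prufer_chart_image: "prufer_chart x ` closed_half_plane = upper_half \<union> rays x"
proof -
  have "Half a b \<in> prufer_chart x ` closed_half_plane" if "b > 0" for a b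
    using that by (intro image_eqI[of _ _ "((a - x) / b, b)"])
      (auto simp: prufer_chart_def closed_half_plane_def)
  moreover have "Ray x s \<in> prufer_chart x ` closed_half_plane" for s
    by (intro image_eqI[of _ _ "(s, 0)"]) (auto simp: prufer_chart_def closed_half_plane_def)
  ultimately show ?thesis
    by (auto simp: prufer_chart_def closed_half_plane_def upper_half_def rays_def)
qed

lemma prufer_chart_inj: "inj_on (prufer_chart x) closed_half_plane"
  by (auto simp: inj_on_def prufer_chart_def closed_half_plane_def split: if_splits)

lemma topspace_prufer [simp]: "topspace prufer = prufer_points"
proof -
  have "{p \<in> closed_half_plane. prufer_chart x p \<in> prufer_points} = closed_half_plane" for x
    using prufer_chart_image[of x] by (auto simp: prufer_points_def)
  then have "openin prufer prufer_points"
    by (simp add: openin_prufer)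
  then show ?thesis
    by (metis openin_prufer openin_subset openin_topspace subset_antisym)
qed

lemma openin_prufer_chart_image:
  assumes W: "openin (top_of_set closed_half_plane) W"
  shows "openin prufer (prufer_chart x ` W)"
  unfolding openin_prufer
proof (intro conjI allI)
  have W': "W \<subseteq> closed_half_plane"
    using W openin_imp_subset by blast
  then show "prufer_chart x ` W \<subseteq> prufer_points"
    using prufer_chart_image[of x] by (auto simp: prufer_points_def)
  fix z
  let ?V = "{p \<in> closed_half_plane. prufer_chart z p \<in> prufer_chart x ` W}"
  show "openin (top_of_set closed_half_plane) ?V"
  proof (cases "z = x")
    case True
    then have "?V = W"
      using W' prufer_chart_inj[of x] by (auto simp: inj_on_def)
    with W show ?thesis by simp
  next
    case False
    define g where "g = (\<lambda>p::real \<times> real. ((z + fst p * snd p - x) / snd p, snd p))"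
    define Q where "Q = (UNIV::real set) \<times> {0::real<..}"
    have "open Q" by (simp add: Q_def open_Times)
    have "continuous_on Q g"
      unfolding g_def Q_def by (auto intro!: continuous_intros)
    moreover have "g \<in> Q \<rightarrow> closed_half_plane"
      by (auto simp: g_def Q_def closed_half_plane_def)
    ultimately have "openin (top_of_set Q) (Q \<inter> g -` W)"
      using W continuous_openin_preimage by blast
    then have op: "open (Q \<inter> g -` W)"
      using \<open>open Q\<close> by (simp add: openin_open_eq)
    have "?V = Q \<inter> g -` W"
    proof (intro set_eqI iffI)
      fix p assume "p \<in> ?V"
      then obtain w where w: "w \<in> W" "prufer_chart z p = prufer_chart x w" and "snd p \<ge> 0"
        by (auto simp: closed_half_plane_def)
      then have "snd p > 0 \<and> w = g p"
        using False by (cases p; cases w)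
          (auto simp: prufer_chart_def g_def split: if_splits)
      with w show "p \<in> Q \<inter> g -` W"
        by (cases p) (auto simp: Q_def)
    next
      fix p assume p: "p \<in> Q \<inter> g -` W"
      then have "prufer_chart z p = prufer_chart x (g p)"
        by (cases p) (auto simp: prufer_chart_def g_def Q_def)
      then show "p \<in> ?V"
        using p by (auto simp: Q_def closed_half_plane_def)
    qed
    moreover have "Q \<inter> g -` W \<subseteq> closed_half_plane"
      by (auto simp: Q_def closed_half_plane_def)
    ultimately show ?thesis
      using op openin_open by (metis Int_absorb1)
  qed
qed

lemma prufer_chart_open: "openin prufer (upper_half \<union> rays x)"
  using openin_prufer_chart_image[of closed_half_plane x] by (simp add: prufer_chart_image)

lemma prufer_chart_homeomorphism:
  "homeomorphic_map (top_of_set closed_half_plane)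
     (subtopology prufer (upper_half \<union> rays x)) (prufer_chart x)"
proof (rule bijective_open_imp_homeomorphic_map)
  have "continuous_map (top_of_set closed_half_plane) prufer (prufer_chart x)"
    using prufer_chart_image[of x]
    by (auto simp: continuous_map_def openin_prufer prufer_points_def)
  then show "continuous_map (top_of_set closed_half_plane)
      (subtopology prufer (upper_half \<union> rays x)) (prufer_chart x)"
    using prufer_chart_image[of x] by (auto simp: continuous_map_in_subtopology)
  show "open_map (top_of_set closed_half_plane)
      (subtopology prufer (upper_half \<union> rays x)) (prufer_chart x)"
    unfolding open_map_def
  proof (intro allI impI)
    fix U assume U: "openin (top_of_set closed_half_plane) U"
    then have "prufer_chart x ` U \<subseteq> upper_half \<union> rays x"
      using prufer_chart_image[of x] openin_imp_subset by blast
    then show "openin (subtopology prufer (upper_half \<union> rays x)) (prufer_chart x ` U)"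
      using openin_prufer_chart_image[OF U] by (simp add: openin_open_subtopology prufer_chart_open)
  qed
  have "upper_half \<union> rays x \<subseteq> prufer_points" by (auto simp: prufer_points_def)
  then show "prufer_chart x ` topspace (top_of_set closed_half_plane) =
      topspace (subtopology prufer (upper_half \<union> rays x))"
    by (simp add: prufer_chart_image Int_absorb1)
  show "inj_on (prufer_chart x) (topspace (top_of_set closed_half_plane))"
    by (simp add: prufer_chart_inj)
qed

lemma prufer_unique:
  assumes top: "topspace X = prufer_points"
    and op: "\<And>x. openin X (upper_half \<union> rays x)"
    and hom: "\<And>x. homeomorphic_map (top_of_set closed_half_plane)
               (subtopology X (upper_half \<union> rays x)) (prufer_chart x)"
  shows "X = prufer"
proof -
  have local: "openin Y U \<longleftrightarrow> (\<forall>x. openin (subtopology Y (upper_half \<union> rays x)) ((upper_half \<union> rays x) \<inter> U))"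
    if "\<And>x. openin Y (upper_half \<union> rays x)" "U \<subseteq> prufer_points" for Y U
  proof
    assume "openin Y U"
    then show "\<forall>x. openin (subtopology Y (upper_half \<union> rays x)) ((upper_half \<union> rays x) \<inter> U)"
      by (simp add: openin_subtopology_Int2)
  next
    assume "\<forall>x. openin (subtopology Y (upper_half \<union> rays x)) ((upper_half \<union> rays x) \<inter> U)"
    then have "openin Y ((upper_half \<union> rays x) \<inter> U)" for x
      by (simp add: openin_open_subtopology[OF that(1)])
    then have "openin Y (\<Union>x. (upper_half \<union> rays x) \<inter> U)"
      by (intro openin_Union) auto
    moreover have "(\<Union>x. (upper_half \<union> rays x) \<inter> U) = U"
      using that(2) by (auto simp: prufer_points_def)
    ultimately show "openin Y U" by simp
  qed
  have chart: "openin (subtopology Y (upper_half \<union> rays x)) V \<longleftrightarrow>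
      openin (top_of_set closed_half_plane) {p \<in> closed_half_plane. prufer_chart x p \<in> V}"
    if "homeomorphic_map (top_of_set closed_half_plane)
          (subtopology Y (upper_half \<union> rays x)) (prufer_chart x)"
      "topspace Y = prufer_points" "V \<subseteq> upper_half \<union> rays x" for Y x V
  proof -
    have "topspace (subtopology Y (upper_half \<union> rays x)) = upper_half \<union> rays x"
      using that(2) by (auto simp: prufer_points_def)
    with that(1,3) show ?thesis
      by (simp add: homeomorphic_map_def quotient_map_def del: topspace_subtopology)
  qed
  have "openin X U \<longleftrightarrow> openin prufer U" for U
  proof (cases "U \<subseteq> prufer_points")
    case True
    then show ?thesis
      unfolding local[OF op True] local[OF prufer_chart_open True]
        chart[OF hom top Int_lower1] chart[OF prufer_chart_homeomorphism topspace_prufer Int_lower1]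
      by (intro refl)
  next
    case False
    then show ?thesis
      using top by (metis openin_subset topspace_prufer)
  qed
  then show ?thesis
    by (simp add: topology_eq)
qed

section \<open>The Moore surface\<close>

definition moore_rel :: "prufer_point rel" where
  "moore_rel = {(p, q). p \<in> prufer_points \<and> q \<in> prufer_points \<and>
     (p = q \<or> (\<exists>x s. p = Ray x s \<and> q = Ray x (- s)))}"

lemma equiv_moore_rel: "equiv prufer_points moore_rel"
  by (rule equivI) (auto simp: moore_rel_def refl_on_def sym_def trans_def)

definition moore_proj :: "prufer_point \<Rightarrow> prufer_point set" where
  "moore_proj p = moore_rel `` {p}"

definition moore :: "prufer_point set topology" where
  "moore = topology (\<lambda>U. U \<subseteq> prufer_points // moore_rel \<and>
     openin prufer {p \<in> prufer_points. moore_proj p \<in> U})"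

lemma openin_moore:
  "openin moore U \<longleftrightarrow> U \<subseteq> prufer_points // moore_rel \<and>
     openin prufer {p \<in> prufer_points. moore_proj p \<in> U}"
proof -
  let ?pre = "\<lambda>U. {p \<in> prufer_points. moore_proj p \<in> U}"
  have 1: "?pre (S \<inter> T) = ?pre S \<inter> ?pre T" for S T by auto
  have 2: "?pre (\<Union>\<K>) = (\<Union>K\<in>\<K>. ?pre K)" for \<K> by auto
  have "istopology (\<lambda>U. U \<subseteq> prufer_points // moore_rel \<and> openin prufer (?pre U))"
    unfolding istopology_def 1 2 by auto
  then show ?thesis
    by (simp add: moore_def)
qed

lemma moore_proj_image: "moore_proj ` prufer_points = prufer_points // moore_rel"
  by (auto simp: moore_proj_def quotient_def)

lemma topspace_moore [simp]: "topspace moore = prufer_points // moore_rel"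
proof -
  have "{p \<in> prufer_points. moore_proj p \<in> prufer_points // moore_rel} = prufer_points"
    using moore_proj_image by auto
  then have "openin moore (prufer_points // moore_rel)"
    using openin_topspace[of prufer] by (simp add: openin_moore)
  then show ?thesis
    by (metis openin_moore openin_subset openin_topspace subset_antisym)
qed

lemma moore_quotient_map: "quotient_map prufer moore moore_proj"
  by (simp add: quotient_map_def moore_proj_image openin_moore)

section \<open>The vertical foliation and flows\<close>

text \<open>The set \<open>T\<^sub>x\<close>.\<close>

definition moore_thorn :: "real \<Rightarrow> prufer_point set set" where
  "moore_thorn x = moore_proj ` rays x"

definition vertical_leaf :: "real \<Rightarrow> prufer_point set set" where
  "vertical_leaf x = moore_proj ` {Half x y | y. y > 0} \<union> moore_thorn x"

definition vertical_leaves :: "prufer_point set set set" where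
  "vertical_leaves = range vertical_leaf"

definition is_flow :: "'a topology \<Rightarrow> (real \<times> 'a \<Rightarrow> 'a) \<Rightarrow> bool" where
  "is_flow X f \<longleftrightarrow> continuous_map (prod_topology euclideanreal X) X f \<and>
     (\<forall>p\<in>topspace X. f (0, p) = p) \<and>
     (\<forall>s t. \<forall>p\<in>topspace X. f (s + t, p) = f (s, f (t, p)))"

definition orbit :: "(real \<times> 'a \<Rightarrow> 'a) \<Rightarrow> 'a \<Rightarrow> 'a set" where
  "orbit f p = f ` (UNIV \<times> {p})"

definition orbits :: "'a topology \<Rightarrow> (real \<times> 'a \<Rightarrow> 'a) \<Rightarrow> 'a set set" where
  "orbits X f = orbit f ` topspace X"

end

theory Submission
  imports Defs
begin

text \<open>Every leaf contains both the half-plane point \<open>(x, 1)\<close> and the end \<open>r\<^sub>x\<^sub>,\<^sub>0\<close> of its thorn, so a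
  compatible flow carries the one to the other in some time \<open>\<tau> x\<close>. The uncountable graph of
  \<open>\<tau>\<close> accumulates at some \<open>(t, x)\<close>. The flow moves \<open>(x, 1)\<close> in time \<open>t\<close> to a point of the open
  set \<open>H \<union> T\<^sub>x\<close>, hence by continuity some \<open>r\<^sub>y\<^sub>,\<^sub>0\<close> with \<open>y \<noteq> x\<close> lies in that set, which is absurd.\<close>

text \<open>Gluing happens only on boundary rays, so the class of a half-plane point is a singleton.
  For \<open>y \<le> 0\<close> the class would be empty and the equivalence false.\<close>

lemma moore_proj_eq_Half_iff:
  assumes "y > 0"
  shows "moore_proj p = moore_proj (Half x y) \<longleftrightarrow> p = Half x y"
  using assms by (auto simp: moore_proj_def moore_rel_def prufer_points_def upper_half_def rays_def)

lemma moore_proj_eq_imp: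
  assumes "moore_proj p = moore_proj q" "p \<in> prufer_points" "q \<in> prufer_points"
  shows "p = q \<or> (\<exists>x s. p = Ray x s \<and> q = Ray x (- s))"
  using eq_equiv_class[OF assms(1)[unfolded moore_proj_def] equiv_moore_rel assms(3)]
  by (auto simp: moore_rel_def)

text \<open>The gluing keeps each boundary component to itself, so no thorn but the one over
  \<open>x\<close> meets this set.\<close>

lemma moore_proj_Ray_in_chart_iff:
  "moore_proj (Ray y s) \<in> moore_proj ` (upper_half \<union> rays x) \<longleftrightarrow> y = x"
proof
  assume "moore_proj (Ray y s) \<in> moore_proj ` (upper_half \<union> rays x)"
  then obtain q where q: "q \<in> upper_half \<union> rays x" "moore_proj (Ray y s) = moore_proj q"
    by auto
  then have "q \<in> prufer_points" "Ray y s \<in> prufer_points"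
    by (auto simp: prufer_points_def rays_def)
  with moore_proj_eq_imp[OF q(2)] q(1) show "y = x"
    by (auto simp: upper_half_def rays_def)
qed (auto simp: rays_def)

text \<open>The set \<open>upper_half \<union> rays x\<close> is saturated: it is the full preimage
  of its image, and it is open in \<open>prufer\<close>.\<close>

lemma openin_moore_chart: "openin moore (moore_proj ` (upper_half \<union> rays x))"
proof -
  have sub: "upper_half \<union> rays x \<subseteq> prufer_points"
    by (auto simp: prufer_points_def)
  have "{p \<in> prufer_points. moore_proj p \<in> moore_proj ` (upper_half \<union> rays x)}
      = upper_half \<union> rays x"
  proof (intro equalityI subsetI)
    fix p assume "p \<in> {p \<in> prufer_points. moore_proj p \<in> moore_proj ` (upper_half \<union> rays x)}"
    then show "p \<in> upper_half \<union> rays x"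
      using moore_proj_Ray_in_chart_iff[of _ _ x] by (cases p) (auto simp: prufer_points_def rays_def)
  qed (use sub in auto)
  with sub show ?thesis
    using moore_proj_image by (auto simp: openin_moore prufer_chart_open)
qed

lemma vertical_leaf_subset_chart: "vertical_leaf x \<subseteq> moore_proj ` (upper_half \<union> rays x)"
  by (auto simp: vertical_leaf_def moore_thorn_def upper_half_def)

text \<open>In the coordinates of \<open>prufer_chart 0\<close> this line is
  \<open>(x / y, y)\<close>, so continuity comes from the plane.\<close>

lemma continuous_map_horizontal_line:
  assumes "y > 0"
  shows "continuous_map euclideanreal prufer (\<lambda>x. Half x y)"
proof -
  have 1: "continuous_map euclideanreal (top_of_set closed_half_plane) (\<lambda>x. (x / y, y))"
    using assms by (auto simp: continuous_map_in_subtopology closed_half_plane_def intro!: continuous_intros)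
  have 2: "continuous_map (top_of_set closed_half_plane) prufer (prufer_chart 0)"
    using homeomorphic_imp_continuous_map[OF prufer_chart_homeomorphism]
    by (simp add: continuous_map_in_subtopology)
  have "prufer_chart 0 \<circ> (\<lambda>x. (x / y, y)) = (\<lambda>x. Half x y)"
    using assms by (auto simp: prufer_chart_def)
  then show ?thesis
    using continuous_map_compose[OF 1 2] by simp
qed

theorem proposition3p4:
  shows "\<not> (\<exists>f. is_flow moore f \<and> orbits moore f = vertical_leaves)"
proof
  assume "\<exists>f. is_flow moore f \<and> orbits moore f = vertical_leaves"
  then obtain f where f: "is_flow moore f" and orb: "orbits moore f = vertical_leaves"
    by blast
  define c where "c = (\<lambda>x. moore_proj (Half x 1))"
  define g where "g = (\<lambda>(t, x). f (t, c x))"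
  have c: "continuous_map euclideanreal moore c"
    using continuous_map_compose[OF continuous_map_horizontal_line[of 1]
        quotient_imp_continuous_map[OF moore_quotient_map]]
    by (simp add: c_def o_def)
  have "continuous_map (prod_topology euclideanreal euclideanreal) moore g"
  proof -
    let ?E = "prod_topology euclideanreal euclideanreal"
    have "continuous_map ?E (prod_topology euclideanreal moore) (\<lambda>q. (fst q, c (snd q)))"
      by (intro continuous_map_pairedI continuous_map_fst
          continuous_map_compose[OF continuous_map_snd c, unfolded o_def])
    moreover have "continuous_map (prod_topology euclideanreal moore) moore f"
      using f by (simp add: is_flow_def)
    ultimately have "continuous_map ?E moore (f \<circ> (\<lambda>q. (fst q, c (snd q))))"
      by (rule continuous_map_compose)
    then show ?thesis
      by (simp add: g_def o_def case_prod_beta')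
  qed
  then have cont: "continuous_map euclidean moore g"
    by (simp add: prod_topology_euclidean)
  \<comment> \<open>The orbit is some leaf; it contains \<open>c x\<close> at time 0, and the
    singleton class \<open>c x\<close> lies on the leaf over \<open>x\<close> only.\<close>
  have orbit_c: "orbit f (c x) = vertical_leaf x" for x
  proof -
    have c_in: "c x \<in> topspace moore"
      using moore_proj_image by (auto simp: c_def prufer_points_def upper_half_def)
    then obtain z where z: "orbit f (c x) = vertical_leaf z"
      using orb unfolding orbits_def vertical_leaves_def by blast
    have "f (0, c x) = c x"
      using f c_in by (auto simp: is_flow_def)
    then have "c x \<in> vertical_leaf z"
      unfolding z[symmetric] orbit_def by force
    then obtain q where "moore_proj q = moore_proj (Half x 1)"
        "q \<in> {Half z y | y. y > 0} \<union> rays z"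
      unfolding c_def vertical_leaf_def moore_thorn_def by (auto simp flip: image_Un)
    then have "z = x"
      by (auto simp: moore_proj_eq_Half_iff rays_def)
    with z show ?thesis by simp
  qed
  \<comment> \<open>This holds at every time \<open>t\<close>, so it applies to a limit point
    \<open>(t, x)\<close> even if \<open>t\<close> differs from \<open>\<tau> x\<close>.\<close>
  have g_chart: "g (t, x) \<in> moore_proj ` (upper_half \<union> rays x)" for t x
    using orbit_c[of x] vertical_leaf_subset_chart[of x] by (auto simp: g_def orbit_def)
  have "\<exists>t. g (t, x) = moore_proj (Ray x 0)" for x
  proof -
    have "moore_proj (Ray x 0) \<in> orbit f (c x)"
      by (auto simp: orbit_c vertical_leaf_def moore_thorn_def rays_def)
    then show ?thesis
      by (auto simp: g_def orbit_def)
  qed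
  then obtain \<tau> where \<tau>: "\<And>x. g (\<tau> x, x) = moore_proj (Ray x 0)"
    by metis
  \<comment> \<open>The graph is used because a limit point in the plane supplies both a time and a
    leaf.\<close>
  define G where "G = range (\<lambda>x. (\<tau> x, x))"
  have "\<not> p islimpt G" for p
  proof
    assume lim: "p islimpt G"
    obtain t x where p: "p = (t, x)"
      by fastforce
    define W where "W = {q. g q \<in> moore_proj ` (upper_half \<union> rays x)}"
    have "open W"
      using openin_continuous_map_preimage[OF cont openin_moore_chart[of x]] by (simp add: W_def)
    moreover have "p \<in> W"
      by (simp add: W_def p g_chart)
    ultimately have "infinite (W \<inter> G)"
      using lim by (simp add: islimpt_eq_acc_point)
    \<comment> \<open>At \<open>(\<tau> y, y)\<close> the value of \<open>g\<close> is the class of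
      \<open>Ray y 0\<close>, which lies in the chart only for \<open>y = x\<close>.\<close>
    moreover have "W \<inter> G \<subseteq> {(\<tau> x, x)}"
      unfolding W_def G_def using \<tau> moore_proj_Ray_in_chart_iff[of _ 0 x] by force
    ultimately show False
      using finite_subset by blast
  qed
  \<comment> \<open>A subset of the plane without limit points is countable, but \<open>G\<close>
    projects onto the reals.\<close>
  then have "G sparse_in UNIV"
    unfolding sparse_in_def by (metis open_UNIV UNIV_I)
  then have "countable G"
    using sparse_imp_countable[of UNIV G] by simp
  moreover have "snd ` G = UNIV"
    by (auto simp: G_def image_image)
  ultimately show False
    by (metis countable_image uncountable_UNIV_real)
qed

end
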